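(* For all integers $t,s\ge 2$, $R^3(HK_t,HK_s)\le 2st(s+t)$.
   Context: For a graph $G=(V,E)$, its 3-expansion $HG$ is the 3-uniform hypergraph obtained by adding to each edge $e\in E$ a new vertex $u_e$, distinct for distinct edges; i.e. $V(HG)=V\cup\{u_e:e\in E\}$ and $E(HG)=\{e\cup\{u_e\}: e\in E\}$. $K_n$ is the complete graph on $n$ vertices. For 3-uniform hypergraphs $\mathcal{F}_1,\mathcal{F}_2$, $R^3(\mathcal{F}_1,\mathcal{F}_2)$ is the least $N$ such that every 2-coloring of the hyperedges of the complete 3-uniform hypergraph on $N$ vertices contains a subhypergraph of the first color isomorphic to $\mathcal{F}_1$ or one of the second color isomorphic to $\mathcal{F}_2$. *)

theory Defs
  imports "HOL-Library.Ramsey"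
begin

type_synonym 'a hypergraph = "'a set \<times> 'a set set"

abbreviation verts :: "'a hypergraph \<Rightarrow> 'a set" where
  "verts H \<equiv> fst H"

abbreviation edges :: "'a hypergraph \<Rightarrow> 'a set set" where
  "edges H \<equiv> snd H"

definition uniform_hypergraph :: "nat \<Rightarrow> 'a hypergraph \<Rightarrow> bool" where
  "uniform_hypergraph r H \<longleftrightarrow> finite (verts H) \<and> edges H \<subseteq> [verts H]\<^bsup>r\<^esup>"

definition complete_hypergraph :: "nat \<Rightarrow> nat \<Rightarrow> nat hypergraph" where
  "complete_hypergraph r n = ({..<n}, [{..<n}]\<^bsup>r\<^esup>)"

definition complete_graph :: "nat \<Rightarrow> nat hypergraph" where
  "complete_graph n = complete_hypergraph 2 n"

text \<open>The new vertex \<open>u\<^sub>e\<close> is \<open>Inr e\<close>; an old vertex \<open>v\<close> becomes \<open>Inl v\<close>.\<close>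

definition expansion3 :: "'a hypergraph \<Rightarrow> ('a + 'a set) hypergraph" where
  "expansion3 G =
    (Inl ` verts G \<union> Inr ` edges G, (\<lambda>e. Inl ` e \<union> {Inr e}) ` edges G)"

definition hypergraph_iso :: "'a hypergraph \<Rightarrow> 'b hypergraph \<Rightarrow> bool" where
  "hypergraph_iso F H \<longleftrightarrow>
    (\<exists>f. bij_betw f (verts F) (verts H) \<and> (\<lambda>e. f ` e) ` edges F = edges H)"

definition subhypergraph :: "'a hypergraph \<Rightarrow> 'a hypergraph \<Rightarrow> bool" where
  "subhypergraph S H \<longleftrightarrow>
    verts S \<subseteq> verts H \<and> edges S \<subseteq> edges H \<and> (\<forall>e\<in>edges S. e \<subseteq> verts S)"

definition contains_coloured_copy ::
    "'a hypergraph \<Rightarrow> ('a set \<Rightarrow> bool) \<Rightarrow> bool \<Rightarrow> 'b hypergraph \<Rightarrow> bool" where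
  "contains_coloured_copy H c b F \<longleftrightarrow>
    (\<exists>S. subhypergraph S H \<and> (\<forall>e\<in>edges S. c e = b) \<and> hypergraph_iso F S)"

text \<open>Colourings are total functions on sets; only their values on hyperedges matter.
  \<open>True\<close> is the first colour, \<open>False\<close> the second.\<close>

definition ramsey3_arrows :: "nat \<Rightarrow> 'a hypergraph \<Rightarrow> 'b hypergraph \<Rightarrow> bool" where
  "ramsey3_arrows N F1 F2 \<longleftrightarrow>
    (\<forall>c. contains_coloured_copy (complete_hypergraph 3 N) c True F1 \<or>
         contains_coloured_copy (complete_hypergraph 3 N) c False F2)"

definition ramsey3 :: "'a hypergraph \<Rightarrow> 'b hypergraph \<Rightarrow> nat" where
  "ramsey3 F1 F2 = (LEAST N. ramsey3_arrows N F1 F2)"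

lemma uniform_expansion3:
  assumes "uniform_hypergraph 2 G"
  shows "uniform_hypergraph 3 (expansion3 G)"
proof -
  have fin: "finite (edges G)"
    using assms unfolding uniform_hypergraph_def
    by (meson finite_imp_finite_nsets finite_subset)
  have "Inl ` e \<union> {Inr e} \<in> [verts (expansion3 G)]\<^bsup>3\<^esup>" if "e \<in> edges G" for e
  proof -
    have e: "e \<subseteq> verts G" "finite e" "card e = 2"
      using assms that by (auto simp: uniform_hypergraph_def nsets_def)
    have "card (Inl ` e \<union> {Inr e} :: ('a + 'a set) set) = 3"
      using e by (simp add: card_insert_if card_image image_iff)
    with e that show ?thesis by (auto simp: expansion3_def nsets_def)
  qed
  with assms fin show ?thesis
    by (auto simp: uniform_hypergraph_def expansion3_def)
qed

lemma contains_coloured_copyI: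
  assumes F: "uniform_hypergraph 3 F" and A: "A \<in> [{..<N}]\<^bsup>card (verts F)\<^esup>"
    and col: "\<And>e. e \<in> [A]\<^bsup>3\<^esup> \<Longrightarrow> c e = b"
  shows "contains_coloured_copy (complete_hypergraph 3 N) c b F"
proof -
  have finA: "finite A" and subA: "A \<subseteq> {..<N}" and "card A = card (verts F)"
    using A by (auto simp: nsets_def)
  then obtain f where f: "bij_betw f (verts F) A"
    using F by (metis finite_same_card_bij uniform_hypergraph_def)
  let ?S = "(A, (\<lambda>e. f ` e) ` edges F)"
  have im: "f ` e \<in> [A]\<^bsup>3\<^esup>" if "e \<in> edges F" for e
    using bij_betw_nsets[OF f, of 3] F that
    by (auto simp: uniform_hypergraph_def bij_betw_def)
  have "subhypergraph ?S (complete_hypergraph 3 N)"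
    unfolding subhypergraph_def complete_hypergraph_def
    using im subA nsets_mono[OF subA, of 3] by (auto simp: nsets_def)
  moreover have "hypergraph_iso F ?S"
    using f by (auto simp: hypergraph_iso_def)
  ultimately show ?thesis
    using im col unfolding contains_coloured_copy_def by (intro exI[of _ ?S]) auto
qed

text \<open>By Ramsey's theorem the \<open>LEAST\<close> in the definition of \<open>ramsey3\<close> is attained.\<close>

lemma ramsey3_arrows_ramsey3:
  assumes F1: "uniform_hypergraph 3 F1" and F2: "uniform_hypergraph 3 F2"
  shows "ramsey3_arrows (ramsey3 F1 F2) F1 F2"
proof -
  obtain N :: nat where N: "partn_lst {..<N} [card (verts F1), card (verts F2)] 3"
    using ramsey_full by blast
  have "ramsey3_arrows N F1 F2"
    unfolding ramsey3_arrows_def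
  proof
    fix c :: "nat set \<Rightarrow> bool"
    let ?g = "\<lambda>e. if c e then 0 else 1 :: nat"
    have "?g \<in> [{..<N}]\<^bsup>3\<^esup> \<rightarrow> {..<length [card (verts F1), card (verts F2)]}" by auto
    with N obtain i A where "i < length [card (verts F1), card (verts F2)]"
      and A: "A \<in> [{..<N}]\<^bsup>([card (verts F1), card (verts F2)] ! i)\<^esup>"
      and m: "?g ` [A]\<^bsup>3\<^esup> \<subseteq> {i}"
      unfolding partn_lst_def monochromatic_def by blast
    then have i: "i < 2" by simp
    show "contains_coloured_copy (complete_hypergraph 3 N) c True F1 \<or>
          contains_coloured_copy (complete_hypergraph 3 N) c False F2"
    proof (cases "i = 0")
      case True
      then have "A \<in> [{..<N}]\<^bsup>card (verts F1)\<^esup>" using A by simp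
      moreover have "c e = True" if "e \<in> [A]\<^bsup>3\<^esup>" for e
        using m that True by (auto simp: image_subset_iff split: if_splits)
      ultimately show ?thesis using contains_coloured_copyI[OF F1] by blast
    next
      case False
      with i have "i = 1" by simp
      then have "A \<in> [{..<N}]\<^bsup>card (verts F2)\<^esup>" using A by simp
      moreover have "c e = False" if "e \<in> [A]\<^bsup>3\<^esup>" for e
        using m that \<open>i = 1\<close> by (auto simp: image_subset_iff split: if_splits)
      ultimately show ?thesis using contains_coloured_copyI[OF F2] by blast
    qed
  qed
  then show ?thesis unfolding ramsey3_def by (rule LeastI)
qed

end

theory Submission
  imports Defs
begin

text \<open>
  Call a pair of vertices \<open>b\<close>-light if it lies in few triples of colour \<open>b\<close>: fewer than
  \<open>t\<^sup>2\<close> for the first colour, fewer than \<open>s\<^sup>2\<close> for the second. If some \<open>t\<close> vertices span no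
  light pair of the first colour, the new vertices can be chosen greedily and give a copy of
  \<open>HK\<^sub>t\<close>; likewise for the second colour. Otherwise both graphs of light pairs have small
  independence number, so fewer than half of the vertices have small degree in either of them,
  and some vertex \<open>v\<close> has large degree in both. Let \<open>A\<close> and \<open>B\<close> be its neighbourhoods for the
  second and the first colour. Every triple \<open>{v, x, y}\<close> with \<open>x \<in> A\<close> and \<open>y \<in> B\<close> either has the
  second colour and is counted at the light pair \<open>{v, x}\<close>, or has the first and is counted at
  \<open>{v, y}\<close>. There are too many such triples for this.
\<close>

definition codegree :: "nat \<Rightarrow> (nat set \<Rightarrow> bool) \<Rightarrow> bool \<Rightarrow> nat set \<Rightarrow> nat" where
  "codegree N c b e = card {z \<in> {..<N} - e. c (insert z e) = b}"

text \<open>Greedy choice: the representatives already chosen number fewer than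
  \<open>card I\<close>, so they never exhaust the next \<open>W j\<close>.\<close>

lemma distinct_representatives_if_large:
  assumes "finite I" "\<And>i. i \<in> I \<Longrightarrow> card I \<le> card (W i)"
  shows "\<exists>g. inj_on g I \<and> (\<forall>i\<in>I. g i \<in> W i)"
  using assms
proof (induction I rule: finite_induct)
  case empty
  then show ?case by simp
next
  case (insert j I)
  then obtain g where g: "inj_on g I" "\<And>i. i \<in> I \<Longrightarrow> g i \<in> W i"
    by (metis card_insert_disjoint insertI2 Suc_leD)
  have "card (g ` I) < card (W j)"
    using insert.prems[of j] insert.hyps card_image_le[of I g] by simp
  then obtain w where w: "w \<in> W j" "w \<notin> g ` I"
    using insert.hyps(1) by (metis card_mono finite_imageI not_le subsetI)
  have "inj_on (g(j := w)) (insert j I)"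
    using g(1) w(2) insert.hyps(2) by (auto simp: inj_on_def)
  moreover have "\<forall>i\<in>insert j I. (g(j := w)) i \<in> W i"
    using g(2) w(1) by auto
  ultimately show ?case by blast
qed

text \<open>Greedy choice again: each chosen vertex removes its closed neighbourhood, at most
  \<open>D\<close> vertices, so \<open>n * D\<close> vertices suffice for \<open>n\<close>
  rounds.\<close>

lemma independent_set_if_bounded_degree:
  assumes "finite L" "D > 0" "n * D \<le> card L"
    and "\<And>v. v \<in> L \<Longrightarrow> card {u \<in> L. u = v \<or> E {v, u}} \<le> D"
  shows "\<exists>K \<subseteq> L. card K = n \<and> (\<forall>e\<in>[K]\<^bsup>2\<^esup>. \<not> E e)"
  using assms
proof (induction n arbitrary: L)
  case 0
  then show ?case by (intro exI[of _ "{}"]) (auto simp: nsets_def)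
next
  case (Suc n)
  then have "card L > 0" by (metis add_gr_0 le_zero_eq mult_Suc not_gr0)
  then obtain v where v: "v \<in> L" by fastforce
  let ?C = "{u \<in> L. u = v \<or> E {v, u}}"
  have "card (L - ?C) = card L - card ?C"
    using Suc.prems(1) by (intro card_Diff_subset) auto
  then have "n * D \<le> card (L - ?C)"
    using Suc.prems(3) Suc.prems(4)[OF v] by simp
  moreover have "card {u \<in> L - ?C. u = w \<or> E {w, u}} \<le> D" if "w \<in> L - ?C" for w
  proof -
    have "card {u \<in> L - ?C. u = w \<or> E {w, u}} \<le> card {u \<in> L. u = w \<or> E {w, u}}"
      using Suc.prems(1) by (intro card_mono) auto
    with Suc.prems(4)[of w] that show ?thesis by auto
  qed
  ultimately obtain K where K: "K \<subseteq> L - ?C" "card K = n" "\<forall>e\<in>[K]\<^bsup>2\<^esup>. \<not> E e"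
    using Suc.IH[of "L - ?C"] Suc.prems(1,2) by blast
  have fK: "finite K" using K(1) Suc.prems(1) by (meson finite_Diff finite_subset)
  have "\<not> E e" if e: "e \<in> [insert v K]\<^bsup>2\<^esup>" for e
  proof (cases "v \<in> e")
    case True
    from e have "card e = 2" "e \<subseteq> insert v K" by (auto simp: nsets_def)
    with True obtain u where "e = {v, u}" "u \<noteq> v" "u \<in> K"
      by (auto simp: card_2_iff doubleton_eq_iff)
    with K(1) show ?thesis by auto
  next
    case False
    with e have "e \<in> [K]\<^bsup>2\<^esup>" by (auto simp: nsets_def)
    with K(3) show ?thesis by blast
  qed
  moreover have "card (insert v K) = Suc n"
    using K(1,2) fK by (subst card_insert_disjoint) auto
  ultimately show ?case
    using K(1) v by (intro exI[of _ "insert v K"]) auto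
qed

text \<open>The vertex \<open>g e\<close> plays the role of the new vertex of the edge
  \<open>e\<close>. Injectivity of \<open>g\<close> and avoidance of \<open>K\<close> keep all
  vertices of the copy distinct.\<close>

lemma contains_coloured_expansionI:
  assumes K: "K \<subseteq> {..<N}" "card K = n"
    and g: "inj_on g ([K]\<^bsup>2\<^esup>)"
      "\<And>e. e \<in> [K]\<^bsup>2\<^esup> \<Longrightarrow> g e \<in> {..<N} - K \<and> c (insert (g e) e) = b"
  shows "contains_coloured_copy (complete_hypergraph 3 N) c b (expansion3 (complete_graph n))"
proof -
  have fK: "finite K" using K(1) finite_subset by blast
  obtain h where h: "bij_betw h {..<n} K"
    using K(2) fK by (metis card_lessThan finite_lessThan finite_same_card_bij)
  have hI: "inj_on (image h) ([{..<n}]\<^bsup>2\<^esup>)" "image h ` [{..<n}]\<^bsup>2\<^esup> = [K]\<^bsup>2\<^esup>"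
    using bij_betw_nsets[OF h, of 2] by (auto simp: bij_betw_def)
  define f where "f = case_sum h (\<lambda>e. g (h ` e))"
  let ?F = "expansion3 (complete_graph n)"
  let ?S = "(f ` verts ?F, (\<lambda>e. f ` e) ` edges ?F)"
  have hK: "h i \<in> K" if "i < n" for i using h that by (auto simp: bij_betw_def)
  have heK: "h ` e \<in> [K]\<^bsup>2\<^esup>" if "e \<in> [{..<n}]\<^bsup>2\<^esup>" for e using hI(2) that by blast
  have F: "verts ?F = Inl ` {..<n} \<union> Inr ` [{..<n}]\<^bsup>2\<^esup>"
    "edges ?F = (\<lambda>e. Inl ` e \<union> {Inr e}) ` [{..<n}]\<^bsup>2\<^esup>"
    by (simp_all add: expansion3_def complete_graph_def complete_hypergraph_def)
  have "inj_on (f \<circ> Inl) {..<n}"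
    using h by (simp add: bij_betw_def f_def comp_def)
  moreover have "inj_on (f \<circ> Inr) ([{..<n}]\<^bsup>2\<^esup>)"
    using comp_inj_on[OF hI(1)] g(1) hI(2) by (simp add: comp_def f_def)
  moreover have "f ` Inl ` {..<n} \<subseteq> K" "f ` Inr ` [{..<n}]\<^bsup>2\<^esup> \<inter> K = {}"
    using hK g(2)[OF heK] by (auto simp: f_def)
  ultimately have "inj_on f (verts ?F)"
    unfolding F inj_on_Un by (blast intro: inj_on_imageI)
  then have iso: "hypergraph_iso ?F ?S"
    by (auto simp: hypergraph_iso_def bij_betw_def)
  have fe: "f ` (Inl ` e \<union> {Inr e}) = insert (g (h ` e)) (h ` e)" for e
    by (simp add: f_def image_Un image_image)
  have ES: "edges ?S = (\<lambda>d. insert (g (h ` d)) (h ` d)) ` [{..<n}]\<^bsup>2\<^esup>"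
    unfolding F by (simp only: snd_conv image_image fe)
  have edge: "e \<in> [{..<N}]\<^bsup>3\<^esup> \<and> c e = b" if e: "e \<in> edges ?S" for e
  proof -
    obtain d where d: "d \<in> [{..<n}]\<^bsup>2\<^esup>" "e = insert (g (h ` d)) (h ` d)"
      using e unfolding ES by blast
    have "h ` d \<subseteq> K" "finite (h ` d)" "card (h ` d) = 2"
      using heK[OF d(1)] by (auto simp: nsets_def)
    with g(2)[OF heK[OF d(1)]] K(1) show ?thesis
      unfolding d(2) nsets_def by (auto simp: card_insert_if)
  qed
  have "verts ?S \<subseteq> {..<N}"
    using subsetD[OF K(1) hK] g(2)[OF heK] by (auto simp: F f_def)
  moreover have "\<forall>e\<in>edges ?F. e \<subseteq> verts ?F"
    unfolding F by (auto simp: nsets_def)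
  then have "\<forall>e\<in>edges ?S. e \<subseteq> verts ?S"
    by (simp add: image_mono)
  ultimately have "subhypergraph ?S (complete_hypergraph 3 N)"
    using edge unfolding subhypergraph_def complete_hypergraph_def fst_conv snd_conv by blast
  with iso edge show ?thesis
    unfolding contains_coloured_copy_def by blast
qed

text \<open>At least \<open>n\<^sup>2 - n\<close> candidates for each new vertex lie outside
  \<open>K\<close>, and there are only \<open>n * (n - 1) div 2\<close> pairs to serve.\<close>

lemma contains_coloured_expansion_if_heavy_clique:
  assumes K: "K \<subseteq> {..<N}" "card K = n"
    and heavy: "\<And>e. e \<in> [K]\<^bsup>2\<^esup> \<Longrightarrow> n\<^sup>2 \<le> codegree N c b e"
  shows "contains_coloured_copy (complete_hypergraph 3 N) c b (expansion3 (complete_graph n))"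
proof -
  have fK: "finite K" using K(1) finite_subset by blast
  let ?Z = "\<lambda>e. {z \<in> {..<N} - e. c (insert z e) = b}"
  have "card ([K]\<^bsup>2\<^esup>) \<le> card (?Z e - K)" if "e \<in> [K]\<^bsup>2\<^esup>" for e
  proof -
    have "card ([K]\<^bsup>2\<^esup>) = n * (n - 1) div 2"
      using K(2) by (simp add: card_nsets choose_two)
    also have "\<dots> \<le> n\<^sup>2 - n"
      by (metis div_le_dividend mult.right_neutral power2_eq_square right_diff_distrib')
    also have "\<dots> \<le> card (?Z e) - card K"
      using heavy[OF that] K(2) by (simp add: codegree_def)
    also have "\<dots> \<le> card (?Z e - K)"
      using fK by (rule diff_card_le_card_Diff)
    finally show ?thesis .
  qed
  then have "\<exists>g. inj_on g ([K]\<^bsup>2\<^esup>) \<and> (\<forall>e\<in>[K]\<^bsup>2\<^esup>. g e \<in> ?Z e - K)"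
    using fK by (intro distinct_representatives_if_large finite_imp_finite_nsets)
  then obtain g where g: "inj_on g ([K]\<^bsup>2\<^esup>)" "\<forall>e\<in>[K]\<^bsup>2\<^esup>. g e \<in> ?Z e - K"
    by (elim exE conjE)
  show ?thesis
    using g(2) by (intro contains_coloured_expansionI[OF K g(1)]) simp
qed

text \<open>Among \<open>n * D\<close> vertices of light degree below \<open>D\<close>, some
  \<open>n\<close> would span no light pair, and these extend to a copy.\<close>

lemma few_low_degree_vertices:
  assumes no_copy:
      "\<not> contains_coloured_copy (complete_hypergraph 3 N) c b (expansion3 (complete_graph n))"
    and "D > 0"
  shows "card {v \<in> {..<N}. card {u \<in> {..<N}. u \<noteq> v \<and> codegree N c b {v, u} < n\<^sup>2} < D} < n * D"
    (is "card ?L < _")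
proof (rule ccontr)
  assume "\<not> card ?L < n * D"
  then have large: "n * D \<le> card ?L" by simp
  have "card {u \<in> ?L. u = v \<or> codegree N c b {v, u} < n\<^sup>2} \<le> D" if "v \<in> ?L" for v
  proof -
    let ?U = "{u \<in> {..<N}. u \<noteq> v \<and> codegree N c b {v, u} < n\<^sup>2}"
    have "card {u \<in> ?L. u = v \<or> codegree N c b {v, u} < n\<^sup>2} \<le> card (insert v ?U)"
      by (intro card_mono) auto
    also have "\<dots> \<le> Suc (card ?U)"
      by (simp add: card_insert_if)
    \<comment> \<open>The strict bound in the definition of low degree leaves room for
      \<open>v\<close> itself.\<close>
    also have "\<dots> \<le> D" using that by simp
    finally show ?thesis .
  qed
  with large \<open>D > 0\<close> obtain K where "K \<subseteq> ?L" "card K = n"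
      "\<forall>e\<in>[K]\<^bsup>2\<^esup>. \<not> codegree N c b e < n\<^sup>2"
    using independent_set_if_bounded_degree[of ?L D n "\<lambda>e. codegree N c b e < n\<^sup>2"] by auto
  then have "contains_coloured_copy (complete_hypergraph 3 N) c b (expansion3 (complete_graph n))"
    by (intro contains_coloured_expansion_if_heavy_clique) (auto simp: not_less)
  with no_copy show False by blast
qed

text \<open>Double counting: the pair \<open>(x, y)\<close> is charged to \<open>x\<close> or to
  \<open>y\<close> according to the colour of \<open>{v, x, y}\<close>.\<close>

lemma light_neighbourhoods_product_less:
  assumes A: "A \<subseteq> {..<N} - {v}" "\<And>x. x \<in> A \<Longrightarrow> codegree N c False {v, x} < p"
    and B: "B \<subseteq> {..<N} - {v}" "\<And>y. y \<in> B \<Longrightarrow> codegree N c True {v, y} < q"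
    and "B \<noteq> {}"
  shows "card A * card B < card A * p + card B * q"
proof -
  have fin: "finite A" "finite B" using A(1) B(1) finite_subset by blast+
  \<comment> \<open>\<open>A\<close> and \<open>B\<close> may overlap. A degenerate pair
    \<open>x = y\<close> is charged here, where the strict bound by \<open>p\<close> has room for
    one more; the strictness of the conclusion then comes from \<open>Y\<close>.\<close>
  define X where "X = (SIGMA x:A. {y \<in> B. y = x \<or> \<not> c {v, x, y}})"
  define Y where "Y = (SIGMA y:B. {x \<in> A. x \<noteq> y \<and> c {v, x, y}})"
  have finXY: "finite X" "finite Y" using fin by (auto simp: X_def Y_def)
  have "card {y \<in> B. y = x \<or> \<not> c {v, x, y}} \<le> p" if "x \<in> A" for x
  proof -
    let ?Z = "{z \<in> {..<N} - {v, x}. c (insert z {v, x}) = False}"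
    have "card {y \<in> B. y = x \<or> \<not> c {v, x, y}} \<le> card (insert x ?Z)"
      using B(1) by (intro card_mono) (auto simp: insert_commute)
    also have "\<dots> \<le> Suc (card ?Z)" by (simp add: card_insert_if)
    also have "\<dots> \<le> p" using A(2)[OF that] unfolding codegree_def by simp
    finally show ?thesis .
  qed
  then have X: "card X \<le> card A * p"
    using fin sum_bounded_above[of A "\<lambda>x. card {y \<in> B. y = x \<or> \<not> c {v, x, y}}" p]
    by (simp add: X_def)
  have "card {x \<in> A. x \<noteq> y \<and> c {v, x, y}} < q" if "y \<in> B" for y
  proof -
    have "card {x \<in> A. x \<noteq> y \<and> c {v, x, y}} \<le> codegree N c True {v, y}"
      unfolding codegree_def using A(1) by (intro card_mono) (auto simp: insert_commute)
    with B(2)[OF that] show ?thesis by simp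
  qed
  then have "(\<Sum>y\<in>B. card {x \<in> A. x \<noteq> y \<and> c {v, x, y}}) < (\<Sum>y\<in>B. q)"
    using fin(2) \<open>B \<noteq> {}\<close> by (intro sum_strict_mono) auto
  then have Y: "card Y < card B * q" using fin by (simp add: Y_def)
  have "A \<times> B \<subseteq> X \<union> prod.swap ` Y" by (force simp: X_def Y_def)
  then have "card (A \<times> B) \<le> card (X \<union> prod.swap ` Y)"
    using finXY by (intro card_mono) auto
  also have "\<dots> \<le> card X + card (prod.swap ` Y)" by (rule card_Un_le)
  also have "\<dots> \<le> card X + card Y"
    using card_image_le[OF finXY(2), of prod.swap] by simp
  finally show ?thesis using X Y by (simp add: card_cartesian_product)
qed

lemma ramsey3_arrows_expansions:
  fixes s t :: nat
  assumes "t > 0" "s > 0"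
  shows "ramsey3_arrows (2 * s * t * (s + t))
    (expansion3 (complete_graph t)) (expansion3 (complete_graph s))"
  unfolding ramsey3_arrows_def
proof (intro allI, rule ccontr)
  fix c :: "nat set \<Rightarrow> bool"
  define N where "N = 2 * s * t * (s + t)"
  assume "\<not> (contains_coloured_copy (complete_hypergraph 3 (2 * s * t * (s + t))) c True
                (expansion3 (complete_graph t)) \<or>
              contains_coloured_copy (complete_hypergraph 3 (2 * s * t * (s + t))) c False
                (expansion3 (complete_graph s)))"
  then have no:
    "\<not> contains_coloured_copy (complete_hypergraph 3 N) c True (expansion3 (complete_graph t))"
    "\<not> contains_coloured_copy (complete_hypergraph 3 N) c False (expansion3 (complete_graph s))"
    by (auto simp: N_def)
  define A where "A v = {u \<in> {..<N}. u \<noteq> v \<and> codegree N c False {v, u} < s\<^sup>2}" for v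
  define B where "B v = {u \<in> {..<N}. u \<noteq> v \<and> codegree N c True {v, u} < t\<^sup>2}" for v
  \<comment> \<open>The thresholds are crossed: the graph of the second colour, with no independent
    set of size \<open>s\<close>, gets \<open>t * (s + t)\<close>, and vice versa. Each exceptional
    set then has fewer than \<open>N / 2\<close> vertices.\<close>
  define L1 where "L1 = {v \<in> {..<N}. card (A v) < t * (s + t)}"
  define L2 where "L2 = {v \<in> {..<N}. card (B v) < s * (s + t)}"
  have "card L1 < s * (t * (s + t))" "card L2 < t * (s * (s + t))"
    using few_low_degree_vertices[OF no(2), of "t * (s + t)"]
      few_low_degree_vertices[OF no(1), of "s * (s + t)"] assms
    by (simp_all add: L1_def L2_def A_def B_def)
  then have "card (L1 \<union> L2) < card {..<N}"
    using card_Un_le[of L1 L2] by (simp add: N_def algebra_simps)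
  moreover have "finite (L1 \<union> L2)" by (simp add: L1_def L2_def)
  ultimately obtain v where "v < N" "v \<notin> L1 \<union> L2"
    by (metis card_mono lessThan_iff not_le subsetI)
  then have deg: "t * (s + t) \<le> card (A v)" "s * (s + t) \<le> card (B v)"
    by (auto simp: L1_def L2_def)
  then have "B v \<noteq> {}" using assms by auto
  then have "card (A v) * card (B v) < card (A v) * s\<^sup>2 + card (B v) * t\<^sup>2"
    by (intro light_neighbourhoods_product_less[of _ N v c]) (auto simp: A_def B_def)
  \<comment> \<open>In fractions, the degree bounds give \<open>s\<^sup>2 / card (B v) + t\<^sup>2 /
    card (A v) \<le> s / (s + t) + t / (s + t) = 1\<close>, against the strict inequality just
    obtained. Multiplying by \<open>s + t\<close> keeps the computation in the naturals.\<close>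
  then have "(s + t) * (card (A v) * card (B v))
      < (s + t) * (card (A v) * s\<^sup>2 + card (B v) * t\<^sup>2)"
    using assms by simp
  also have "\<dots> = (card (A v) * s) * (s * (s + t)) + (card (B v) * t) * (t * (s + t))"
    by (simp add: algebra_simps power2_eq_square)
  also have "\<dots> \<le> (card (A v) * s) * card (B v) + (card (B v) * t) * card (A v)"
    using deg by (intro add_mono mult_left_mono) auto
  also have "\<dots> = (s + t) * (card (A v) * card (B v))"
    by (simp add: algebra_simps)
  finally show False by simp
qed

theorem theorem1p11:
  fixes s t :: nat
  assumes "t \<ge> 2" and "s \<ge> 2"
  shows "ramsey3 (expansion3 (complete_graph t)) (expansion3 (complete_graph s))
           \<le> 2 * s * t * (s + t)"
  unfolding ramsey3_def using assms by (intro Least_le ramsey3_arrows_expansions) auto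

end
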